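(* Let $\tau:E\to E$ be a state operator on the effect algebra $E$. Let $(T,\rho)$ be the tensor product of $[0,1]$ and $E$. Then $\tau$ uniquely extends to a state operator on $T$.
   Context: An effect algebra is $(E;0,1,\oplus)$ with a partial binary operation $\oplus$ that is commutative and associative (in the partial sense), such that for each $e$ there is a unique $e^\perp$ with $e\oplus e^\perp=1$, and $e\oplus 1$ is defined only if $e=0$. Write $a\perp b$ if $a\oplus b$ is defined. The real interval $[0,1]$ is an effect algebra with $a\oplus b=a+b$ defined iff $a+b\le1$. A morphism $\phi:E\to F$ satisfies $\phi(1)=1$ and: $a\perp b$ implies $\phi(a)\perp\phi(b)$ and $\phi(a\oplus b)=\phi(a)\oplus\phi(b)$. A bimorphism $\beta:E\times F\to L$ preserves existing orthosums in each variable separately and satisfies $\beta(1,1)=1$. A tensor product of $E$ and $F$ (in the category of effect algebras) is a pair $(T,\rho)$ with $T$ an effect algebra and $\rho:E\times F\to T$ a bimorphism such that for every effect algebra $L$ and bimorphism $\beta:E\times F\to L$ there is a unique morphism $\phi:T\to L$ with $\beta=\phi\circ\rho$. Here $E$ is regarded as embedded into $T=[0,1]\otimes E$ (via $a\mapsto\rho(1,a)$), and "extends" refers to this embedding. A state operator on an effect algebra $E$ is a map $\tau:E\to E$ with $\tau(1)=1$; $\tau(e\oplus f)=\tau(e)\oplus\tau(f)$ whenever $e\oplus f$ is defined; and $\tau(\tau(a))=\tau(a)$ for all $a$.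
   Formalization: "Extends" is taken to mean τ'(ρ(r,a)) = ρ(r,τ(a)) for all r in [0,1], not only r = 1; with r = 1 alone uniqueness fails, e.g. for E the interval [(0,0),(1,0)] in lexicographic Z×Z with τ(x,y) = (x,0). *)

theory Defs
  imports Complex_Main "HOL-Library.FuncSet"
begin

record 'a effect_alg =
  carrier :: "'a set"
  zero :: "'a"
  one :: "'a"
  osum :: "'a \<Rightarrow> 'a \<Rightarrow> 'a option"

locale effect_algebra =
  fixes E :: "'a effect_alg"
  assumes zero_closed: "zero E \<in> carrier E"
    and one_closed: "one E \<in> carrier E"
    and osum_closed: "\<lbrakk>a \<in> carrier E; b \<in> carrier E; osum E a b = Some c\<rbrakk> \<Longrightarrow> c \<in> carrier E"
    and osum_commute: "\<lbrakk>a \<in> carrier E; b \<in> carrier E\<rbrakk> \<Longrightarrow> osum E a b = osum E b a"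
    and osum_assoc: "\<lbrakk>a \<in> carrier E; b \<in> carrier E; c \<in> carrier E;
        osum E b c = Some d; osum E a d = Some e\<rbrakk>
        \<Longrightarrow> \<exists>f. osum E a b = Some f \<and> osum E f c = Some e"
    and orthosupplement: "a \<in> carrier E \<Longrightarrow> \<exists>!b. b \<in> carrier E \<and> osum E a b = Some (one E)"
    and osum_one: "\<lbrakk>a \<in> carrier E; osum E a (one E) \<noteq> None\<rbrakk> \<Longrightarrow> a = zero E"

definition unit_interval :: "real effect_alg" where
  "unit_interval = \<lparr>carrier = {0..1}, zero = 0, one = 1,
     osum = (\<lambda>a b. if a + b \<le> 1 then Some (a + b) else None)\<rparr>"

definition ea_morphism :: "'a effect_alg \<Rightarrow> 'b effect_alg \<Rightarrow> ('a \<Rightarrow> 'b) \<Rightarrow> bool" where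
  "ea_morphism E F \<phi> \<longleftrightarrow>
     (\<forall>a\<in>carrier E. \<phi> a \<in> carrier F) \<and>
     \<phi> (one E) = one F \<and>
     (\<forall>a\<in>carrier E. \<forall>b\<in>carrier E. \<forall>c.
        osum E a b = Some c \<longrightarrow> osum F (\<phi> a) (\<phi> b) = Some (\<phi> c))"

definition ea_bimorphism ::
    "'a effect_alg \<Rightarrow> 'b effect_alg \<Rightarrow> 'l effect_alg \<Rightarrow> ('a \<times> 'b \<Rightarrow> 'l) \<Rightarrow> bool" where
  "ea_bimorphism E F L \<beta> \<longleftrightarrow>
     (\<forall>a\<in>carrier E. \<forall>b\<in>carrier F. \<beta> (a, b) \<in> carrier L) \<and>
     \<beta> (one E, one F) = one L \<and>
     (\<forall>a\<in>carrier E. \<forall>a'\<in>carrier E. \<forall>c. \<forall>b\<in>carrier F.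
        osum E a a' = Some c \<longrightarrow> osum L (\<beta> (a, b)) (\<beta> (a', b)) = Some (\<beta> (c, b))) \<and>
     (\<forall>a\<in>carrier E. \<forall>b\<in>carrier F. \<forall>b'\<in>carrier F. \<forall>c.
        osum F b b' = Some c \<longrightarrow> osum L (\<beta> (a, b)) (\<beta> (a, b')) = Some (\<beta> (a, c)))"

text \<open>Maps are identified when they agree on the carrier of \<open>T\<close>, hence the restriction to
  extensional functions.\<close>

definition factors_uniquely ::
    "'a effect_alg \<Rightarrow> 'b effect_alg \<Rightarrow> 't effect_alg \<Rightarrow> ('a \<times> 'b \<Rightarrow> 't) \<Rightarrow>
     'l effect_alg \<Rightarrow> ('a \<times> 'b \<Rightarrow> 'l) \<Rightarrow> bool" where
  "factors_uniquely E F T \<rho> L \<beta> \<longleftrightarrow>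
     (\<exists>!\<phi>. \<phi> \<in> extensional (carrier T) \<and> ea_morphism T L \<phi> \<and>
        (\<forall>a\<in>carrier E. \<forall>b\<in>carrier F. \<beta> (a, b) = \<phi> (\<rho> (a, b))))"

text \<open>A formula cannot quantify over the types of all effect algebras \<open>L\<close>. The definition below
  therefore lets \<open>L\<close> range over the effect algebras carried by sets of formal terms over
  \<open>E \<times> F\<close> and \<open>T\<close>. This is no restriction: by theorem \<open>tensor_product_universal\<close> the universal
  property then holds for effect algebras \<open>L\<close> over every type.\<close>

datatype 'g eterm = Gen 'g | Sum "'g eterm" "'g eterm" | Compl "'g eterm"

definition tensor_product ::
    "'a effect_alg \<Rightarrow> 'b effect_alg \<Rightarrow> 't effect_alg \<Rightarrow> ('a \<times> 'b \<Rightarrow> 't) \<Rightarrow> bool" where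
  "tensor_product E F T \<rho> \<longleftrightarrow>
     effect_algebra T \<and> ea_bimorphism E F T \<rho> \<and>
     (\<forall>(L :: ('a \<times> 'b + 't) eterm effect_alg) \<beta>.
        effect_algebra L \<and> ea_bimorphism E F L \<beta> \<longrightarrow> factors_uniquely E F T \<rho> L \<beta>)"

definition state_operator :: "'a effect_alg \<Rightarrow> ('a \<Rightarrow> 'a) \<Rightarrow> bool" where
  "state_operator E \<tau> \<longleftrightarrow>
     (\<forall>a\<in>carrier E. \<tau> a \<in> carrier E) \<and>
     \<tau> (one E) = one E \<and>
     (\<forall>a\<in>carrier E. \<forall>b\<in>carrier E. \<forall>c.
        osum E a b = Some c \<longrightarrow> osum E (\<tau> a) (\<tau> b) = Some (\<tau> c)) \<and>
     (\<forall>a\<in>carrier E. \<tau> (\<tau> a) = \<tau> a)"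

text \<open>\<open>E\<close> sits in \<open>T = [0,1] \<otimes> E\<close> as the elements \<open>\<rho> (1, a)\<close>, and \<open>\<rho> (r, a)\<close> is the multiple
  of that element by the scalar \<open>r\<close>. An extension of \<open>\<tau>\<close> to \<open>T\<close> is understood to respect these
  multiples. The condition for \<open>r = 1\<close> alone would not determine it: let \<open>E\<close> be the interval
  from \<open>(0,0)\<close> to \<open>(1,0)\<close> in the lexicographically ordered group \<open>\<int> \<times> \<int>\<close>, so that \<open>T\<close> is the
  interval with the same endpoints in the lexicographically ordered plane, and let
  \<open>\<tau> (x, y) = (x, 0)\<close>. For every additive \<open>d\<close> on the reals that vanishes on the rationals,
  \<open>(x, y) \<mapsto> (x, d x)\<close> is a state operator on \<open>T\<close> which agrees with \<open>\<tau>\<close> on \<open>E\<close>.\<close>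

definition extends_state_operator ::
    "'a effect_alg \<Rightarrow> (real \<times> 'a \<Rightarrow> 't) \<Rightarrow> ('a \<Rightarrow> 'a) \<Rightarrow> ('t \<Rightarrow> 't) \<Rightarrow> bool" where
  "extends_state_operator E \<rho> \<tau> \<tau>' \<longleftrightarrow>
     (\<forall>r\<in>carrier unit_interval. \<forall>a\<in>carrier E. \<tau>' (\<rho> (r, a)) = \<rho> (r, \<tau> a))"

subsection \<open>The universal property over arbitrary types\<close>

text \<open>The value of a formal term; an undefined orthosum evaluates to \<open>zero L\<close>.\<close>

primrec evalt :: "'l effect_alg \<Rightarrow> ('g \<Rightarrow> 'l) \<Rightarrow> 'g eterm \<Rightarrow> 'l" where
  "evalt L f (Gen g) = f g"
| "evalt L f (Sum s t) =
     (case osum L (evalt L f s) (evalt L f t) of None \<Rightarrow> zero L | Some z \<Rightarrow> z)"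
| "evalt L f (Compl t) = (THE y. y \<in> carrier L \<and> osum L (evalt L f t) y = Some (one L))"

context effect_algebra
begin

lemma compl_props:
  assumes "a \<in> carrier E"
  shows "(THE y. y \<in> carrier E \<and> osum E a y = Some (one E)) \<in> carrier E"
    and "osum E a (THE y. y \<in> carrier E \<and> osum E a y = Some (one E)) = Some (one E)"
  using theI'[OF orthosupplement[OF assms]] by auto

lemma compl_unique:
  assumes "a \<in> carrier E" "b \<in> carrier E" "osum E a b = Some (one E)"
  shows "(THE y. y \<in> carrier E \<and> osum E a y = Some (one E)) = b"
  using the1_equality[OF orthosupplement[OF assms(1)]] assms by auto

lemma zero_one: "osum E (zero E) (one E) = Some (one E)"
proof -
  obtain b where b: "b \<in> carrier E" "osum E (one E) b = Some (one E)"
    using orthosupplement[OF one_closed] by auto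
  have "osum E b (one E) = Some (one E)"
    using b osum_commute[OF one_closed b(1)] by simp
  then show ?thesis using osum_one[OF b(1)] by auto
qed

lemma evalt_closed:
  assumes "\<And>g. f g \<in> carrier E"
  shows "evalt E f t \<in> carrier E"
proof (induction t)
  case (Gen g)
  then show ?case using assms by simp
next
  case (Sum s t)
  then show ?case
    using zero_closed osum_closed[OF Sum.IH] by (cases "osum E (evalt E f s) (evalt E f t)") simp_all
next
  case (Compl t)
  then show ?case using compl_props(1) by simp
qed

end

lemma ea_morphism_zero:
  assumes "effect_algebra E" "effect_algebra F" "ea_morphism E F \<phi>"
  shows "\<phi> (zero E) = zero F"
proof -
  interpret E: effect_algebra E by fact
  interpret F: effect_algebra F by fact
  have "osum F (\<phi> (zero E)) (one F) = Some (one F)"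
    using assms(3) E.zero_one E.zero_closed E.one_closed unfolding ea_morphism_def by metis
  then show ?thesis
    using F.osum_one assms(3) E.zero_closed unfolding ea_morphism_def by auto
qed

lemma ea_morphisms_eq_evalt:
  assumes "effect_algebra E" "effect_algebra F" "ea_morphism E F \<phi>" "ea_morphism E F \<psi>"
    and f: "\<And>g. f g \<in> carrier E" "\<And>g. \<phi> (f g) = \<psi> (f g)"
  shows "\<phi> (evalt E f t) = \<psi> (evalt E f t)"
proof (induction t)
  case (Gen g)
  then show ?case using f by simp
next
  case (Sum s t)
  let ?x = "evalt E f s" and ?y = "evalt E f t"
  interpret E: effect_algebra E by fact
  have c: "?x \<in> carrier E" "?y \<in> carrier E" using E.evalt_closed[of f, OF f(1)] by blast+
  show ?case
  proof (cases "osum E ?x ?y")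
    case None
    then show ?thesis using ea_morphism_zero assms(1-4) by (metis evalt.simps(2) option.simps(4))
  next
    case (Some z)
    have "osum F (\<phi> ?x) (\<phi> ?y) = Some (\<phi> z)" "osum F (\<psi> ?x) (\<psi> ?y) = Some (\<psi> z)"
      using assms(3,4) c Some unfolding ea_morphism_def by auto
    then show ?thesis using Some Sum by simp
  qed
next
  case (Compl t)
  interpret E: effect_algebra E by fact
  interpret F: effect_algebra F by fact
  let ?x = "evalt E f t" and ?y = "evalt E f (Compl t)"
  have c: "?x \<in> carrier E" "?y \<in> carrier E" using E.evalt_closed[of f, OF f(1)] by blast+
  have s: "osum E ?x ?y = Some (one E)" using E.compl_props(2)[OF c(1)] by simp
  have "osum F (\<phi> ?x) (\<phi> ?y) = Some (\<phi> (one E))" "\<phi> (one E) = one F"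
    "osum F (\<psi> ?x) (\<psi> ?y) = Some (\<psi> (one E))" "\<psi> (one E) = one F"
    using assms(3,4) c s unfolding ea_morphism_def by blast+
  moreover have "\<phi> ?x \<in> carrier F" "\<phi> ?y \<in> carrier F" "\<psi> ?y \<in> carrier F"
    using assms(3,4) c unfolding ea_morphism_def by blast+
  ultimately show ?case
    using F.orthosupplement[of "\<phi> ?x"] Compl by auto
qed

lemma ea_morphism_comp:
  assumes "ea_morphism E F \<phi>" "ea_morphism F G \<psi>"
  shows "ea_morphism E G (\<lambda>x. \<psi> (\<phi> x))"
  using assms unfolding ea_morphism_def by auto

lemma ea_morphism_restrict:
  assumes "effect_algebra E" "ea_morphism E F \<phi>"
  shows "ea_morphism E F (restrict \<phi> (carrier E))"
proof -
  interpret effect_algebra E by fact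
  show ?thesis
    unfolding ea_morphism_def
  proof (intro conjI ballI allI impI)
    fix a b c assume ab: "a \<in> carrier E" "b \<in> carrier E" "osum E a b = Some c"
    then have "c \<in> carrier E" by (rule osum_closed)
    then show "osum F (restrict \<phi> (carrier E) a) (restrict \<phi> (carrier E) b) =
        Some (restrict \<phi> (carrier E) c)"
      using ab assms(2) unfolding ea_morphism_def by simp
  next
    fix a assume "a \<in> carrier E"
    then show "restrict \<phi> (carrier E) a \<in> carrier F"
      using assms(2) unfolding ea_morphism_def by simp
  next
    show "restrict \<phi> (carrier E) (one E) = one F"
      using assms(2) one_closed unfolding ea_morphism_def by simp
  qed
qed

text \<open>The effect algebra generated by the values of \<open>f\<close>, copied to a set of terms.\<close>

definition code :: "'l effect_alg \<Rightarrow> ('g \<Rightarrow> 'l) \<Rightarrow> 'l \<Rightarrow> 'g eterm" where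
  "code L f = inv (evalt L f)"

definition coded :: "'l effect_alg \<Rightarrow> ('g \<Rightarrow> 'l) \<Rightarrow> 'g eterm effect_alg" where
  "coded L f = \<lparr>carrier = code L f ` range (evalt L f), zero = code L f (zero L),
     one = code L f (one L),
     osum = (\<lambda>s t. map_option (code L f) (osum L (evalt L f s) (evalt L f t)))\<rparr>"

lemma evalt_code: "x \<in> range (evalt L f) \<Longrightarrow> evalt L f (code L f x) = x"
  unfolding code_def by (rule f_inv_into_f)

locale coding = effect_algebra L for L :: "'l effect_alg" +
  fixes f :: "'g \<Rightarrow> 'l"
  assumes f_closed: "f g \<in> carrier L"
begin

abbreviation "S \<equiv> range (evalt L f)"

lemma S_carrier: "x \<in> S \<Longrightarrow> x \<in> carrier L"
  using evalt_closed f_closed by auto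

lemma S_osum:
  assumes "x \<in> S" "y \<in> S" "osum L x y = Some z"
  shows "z \<in> S"
proof -
  obtain s t where "x = evalt L f s" "y = evalt L f t" using assms by auto
  then have "z = evalt L f (Sum s t)" using assms by simp
  then show ?thesis by blast
qed

lemma S_compl:
  assumes "x \<in> S" shows "\<exists>y\<in>S. osum L x y = Some (one L)"
proof -
  obtain s where s: "x = evalt L f s" using assms by auto
  then have "osum L x (evalt L f (Compl s)) = Some (one L)"
    using compl_props(2) S_carrier assms by simp
  then show ?thesis by blast
qed

lemma S_one: "one L \<in> S"
proof -
  have "evalt L f (Gen undefined) \<in> S" by blast
  then show ?thesis using S_compl S_osum by blast
qed

lemma S_zero: "zero L \<in> S"
proof -
  obtain y where "y \<in> S" "osum L (one L) y = Some (one L)" using S_compl S_one by blast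
  moreover have "zero L \<in> carrier L \<and> osum L (one L) (zero L) = Some (one L)"
    using zero_one zero_closed osum_commute one_closed by metis
  ultimately show ?thesis using orthosupplement[OF one_closed] S_carrier by metis
qed

lemma code_eq_iff: "x \<in> S \<Longrightarrow> y \<in> S \<Longrightarrow> code L f x = code L f y \<longleftrightarrow> x = y"
  using evalt_code by metis

lemma osum_coded:
  "x \<in> S \<Longrightarrow> y \<in> S \<Longrightarrow>
   osum (coded L f) (code L f x) (code L f y) = map_option (code L f) (osum L x y)"
  by (simp add: coded_def evalt_code)

lemma coded_simps:
  "carrier (coded L f) = code L f ` S" "zero (coded L f) = code L f (zero L)"
  "one (coded L f) = code L f (one L)"
  by (simp_all add: coded_def)

lemma osum_coded_Some:
  assumes "x \<in> S" "y \<in> S"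
  shows "osum (coded L f) (code L f x) (code L f y) = Some w \<longleftrightarrow>
    (\<exists>z\<in>S. osum L x y = Some z \<and> w = code L f z)"
  using S_osum[OF assms] assms by (auto simp: osum_coded)

lemma effect_algebra_coded: "effect_algebra (coded L f)"
proof
  show "zero (coded L f) \<in> carrier (coded L f)" "one (coded L f) \<in> carrier (coded L f)"
    using S_zero S_one by (auto simp: coded_simps)
next
  fix a b c assume "a \<in> carrier (coded L f)" "b \<in> carrier (coded L f)"
    and s: "osum (coded L f) a b = Some c"
  then obtain x y where "x \<in> S" "y \<in> S" "a = code L f x" "b = code L f y"
    unfolding coded_simps by blast
  then show "c \<in> carrier (coded L f)" using s osum_coded_Some coded_simps(1) by blast
next
  fix a b assume "a \<in> carrier (coded L f)" "b \<in> carrier (coded L f)"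
  then obtain x y where "x \<in> S" "y \<in> S" "a = code L f x" "b = code L f y"
    unfolding coded_simps by blast
  then show "osum (coded L f) a b = osum (coded L f) b a"
    using osum_coded osum_commute S_carrier by metis
next
  fix a b c d e
  assume "a \<in> carrier (coded L f)" "b \<in> carrier (coded L f)" "c \<in> carrier (coded L f)"
    and s: "osum (coded L f) b c = Some d" "osum (coded L f) a d = Some e"
  then obtain x y z where S: "x \<in> S" "y \<in> S" "z \<in> S"
    and eq: "a = code L f x" "b = code L f y" "c = code L f z"
    unfolding coded_simps by blast
  obtain u where u: "u \<in> S" "osum L y z = Some u" "d = code L f u"
    using s(1) osum_coded_Some S unfolding eq by blast
  obtain v where v: "v \<in> S" "osum L x u = Some v" "e = code L f v"
    using s(2) osum_coded_Some S u unfolding eq by blast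
  obtain w where w: "osum L x y = Some w" "osum L w z = Some v"
    using osum_assoc[OF S[THEN S_carrier] u(2) v(2)] by blast
  have "w \<in> S" using S_osum S w by blast
  then show "\<exists>f'. osum (coded L f) a b = Some f' \<and> osum (coded L f) f' c = Some e"
    using w S v osum_coded unfolding eq by (metis option.simps(9))
next
  fix a assume "a \<in> carrier (coded L f)"
  then obtain x where x: "x \<in> S" "a = code L f x" unfolding coded_simps by blast
  obtain y where y: "y \<in> S" "osum L x y = Some (one L)" using S_compl x by blast
  show "\<exists>!b. b \<in> carrier (coded L f) \<and> osum (coded L f) a b = Some (one (coded L f))"
  proof (rule ex1I[of _ "code L f y"])
    show "code L f y \<in> carrier (coded L f) \<and>
        osum (coded L f) a (code L f y) = Some (one (coded L f))"
      using x y osum_coded by (simp add: coded_simps)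
  next
    fix b assume b: "b \<in> carrier (coded L f) \<and> osum (coded L f) a b = Some (one (coded L f))"
    then obtain y' where y': "y' \<in> S" "b = code L f y'" unfolding coded_simps by blast
    then obtain z where "z \<in> S" "osum L x y' = Some z" "code L f (one L) = code L f z"
      using b x osum_coded_Some coded_simps(3) by metis
    then have "osum L x y' = Some (one L)" using code_eq_iff S_one by auto
    then have "y' = y" using orthosupplement S_carrier x y y' by metis
    then show "b = code L f y" using y' by simp
  qed
next
  fix a assume "a \<in> carrier (coded L f)" and n: "osum (coded L f) a (one (coded L f)) \<noteq> None"
  then obtain x where x: "x \<in> S" "a = code L f x" unfolding coded_simps by blast
  then have "osum L x (one L) \<noteq> None" using n osum_coded S_one by (auto simp: coded_simps)
  then have "x = zero L" using osum_one S_carrier x by blast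
  then show "a = zero (coded L f)" using x by (simp add: coded_simps)
qed

lemma ea_morphism_evalt: "ea_morphism (coded L f) L (evalt L f)"
  unfolding ea_morphism_def
proof (intro conjI ballI allI impI)
  fix a assume "a \<in> carrier (coded L f)"
  then show "evalt L f a \<in> carrier L" using S_carrier by blast
next
  show "evalt L f (one (coded L f)) = one L" using evalt_code S_one by (simp add: coded_simps)
next
  fix a b c assume "a \<in> carrier (coded L f)" "b \<in> carrier (coded L f)"
    and s: "osum (coded L f) a b = Some c"
  then obtain x y where xy: "x \<in> S" "y \<in> S" "a = code L f x" "b = code L f y"
    unfolding coded_simps by blast
  then obtain z where "z \<in> S" "osum L x y = Some z" "c = code L f z"
    using s osum_coded_Some by blast
  then show "osum L (evalt L f a) (evalt L f b) = Some (evalt L f c)"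
    using xy by (simp add: evalt_code)
qed

lemma ea_morphism_code:
  assumes "carrier L \<subseteq> S" shows "ea_morphism L (coded L f) (code L f)"
  unfolding ea_morphism_def using assms osum_coded by (auto simp: coded_simps subset_iff)

lemma ea_bimorphism_code:
  assumes "ea_bimorphism E F L \<beta>" "\<And>a b. a \<in> carrier E \<Longrightarrow> b \<in> carrier F \<Longrightarrow> \<beta> (a, b) \<in> S"
  shows "ea_bimorphism E F (coded L f) (\<lambda>p. code L f (\<beta> p))"
  using assms unfolding ea_bimorphism_def by (simp add: osum_coded coded_simps)

end

definition bigen ::
    "'a effect_alg \<Rightarrow> 'b effect_alg \<Rightarrow> 'l effect_alg \<Rightarrow> ('a \<times> 'b \<Rightarrow> 'l) \<Rightarrow> 'a \<times> 'b + 't \<Rightarrow> 'l" where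
  "bigen E F L \<beta> g = (case g of Inl p \<Rightarrow> if p \<in> carrier E \<times> carrier F then \<beta> p else one L
     | Inr _ \<Rightarrow> one L)"

lemma coding_bigen:
  fixes E :: "'a effect_alg" and F :: "'b effect_alg"
  assumes "effect_algebra L" "ea_bimorphism E F L \<beta>"
  shows "coding L (bigen E F L \<beta> :: 'a \<times> 'b + 't \<Rightarrow> _)"
proof -
  interpret effect_algebra L by fact
  have "bigen E F L \<beta> g \<in> carrier L" for g :: "'a \<times> 'b + 't"
    using assms(2) one_closed unfolding ea_bimorphism_def
    by (cases g) (auto simp: bigen_def)
  then show ?thesis by unfold_locales
qed

lemma tensor_product_factors:
  fixes L :: "'l effect_alg" and T :: "'t effect_alg"
    and E :: "'a effect_alg" and F :: "'b effect_alg"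
  assumes tp: "tensor_product E F T \<rho>"
    and L: "effect_algebra L" and \<beta>: "ea_bimorphism E F L \<beta>"
  obtains \<phi> where "ea_morphism T L \<phi>"
    "\<And>a b. a \<in> carrier E \<Longrightarrow> b \<in> carrier F \<Longrightarrow> \<beta> (a, b) = \<phi> (\<rho> (a, b))"
    "\<And>t. t \<in> carrier T \<Longrightarrow> \<phi> t \<in> range (evalt L (bigen E F L \<beta> :: 'a \<times> 'b + 't \<Rightarrow> 'l))"
proof -
  let ?f = "bigen E F L \<beta> :: 'a \<times> 'b + 't \<Rightarrow> 'l"
  interpret coding L ?f using coding_bigen L \<beta> .
  have S: "\<beta> (a, b) \<in> S" if "a \<in> carrier E" "b \<in> carrier F" for a b
  proof -
    have "evalt L ?f (Gen (Inl (a, b))) = \<beta> (a, b)" using that by (simp add: bigen_def)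
    then show ?thesis by (metis rangeI)
  qed
  have "factors_uniquely E F T \<rho> (coded L ?f) (\<lambda>p. code L ?f (\<beta> p))"
    using tp effect_algebra_coded ea_bimorphism_code[OF \<beta> S] unfolding tensor_product_def by blast
  then obtain \<phi> where \<phi>: "ea_morphism T (coded L ?f) \<phi>"
    "\<forall>a\<in>carrier E. \<forall>b\<in>carrier F. code L ?f (\<beta> (a, b)) = \<phi> (\<rho> (a, b))"
    unfolding factors_uniquely_def by blast
  show ?thesis
  proof (rule that[of "\<lambda>t. evalt L ?f (\<phi> t)"])
    show "ea_morphism T L (\<lambda>t. evalt L ?f (\<phi> t))"
      using ea_morphism_comp \<phi>(1) ea_morphism_evalt by blast
    show "\<beta> (a, b) = evalt L ?f (\<phi> (\<rho> (a, b)))" if "a \<in> carrier E" "b \<in> carrier F" for a b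
      using \<phi>(2) that S evalt_code by metis
  qed auto
qed

theorem tensor_product_universal:
  fixes L :: "'l effect_alg" and T :: "'t effect_alg"
    and E :: "'a effect_alg" and F :: "'b effect_alg"
  assumes tp: "tensor_product E F T \<rho>"
    and L: "effect_algebra L" and \<beta>: "ea_bimorphism E F L \<beta>"
  shows "factors_uniquely E F T \<rho> L \<beta>"
proof -
  have T: "effect_algebra T" and \<rho>: "ea_bimorphism E F T \<rho>"
    using tp unfolding tensor_product_def by auto
  interpret T: effect_algebra T by fact
  let ?g = "bigen E F T \<rho> :: 'a \<times> 'b + 't \<Rightarrow> 't"
  have \<rho>T: "\<rho> (a, b) \<in> carrier T" if "a \<in> carrier E" "b \<in> carrier F" for a b
    using \<rho> that unfolding ea_bimorphism_def by auto
  have generated: "t \<in> range (evalt T ?g)" if t: "t \<in> carrier T" for t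
  proof -
    obtain \<pi> where \<pi>: "ea_morphism T T \<pi>"
      "\<And>a b. a \<in> carrier E \<Longrightarrow> b \<in> carrier F \<Longrightarrow> \<rho> (a, b) = \<pi> (\<rho> (a, b))"
      "\<And>t. t \<in> carrier T \<Longrightarrow> \<pi> t \<in> range (evalt T ?g)"
      using tensor_product_factors[OF tp T \<rho>] by blast
    define h :: "'a \<times> 'b + 't \<Rightarrow> 't" where
      "h g = (case g of Inl _ \<Rightarrow> one T | Inr t \<Rightarrow> if t \<in> carrier T then t else one T)" for g
    interpret h: coding T h
      using T.one_closed by unfold_locales (simp add: h_def split: sum.split)
    have sub: "x \<in> h.S" if "x \<in> carrier T" for x
    proof -
      have "evalt T h (Gen (Inr x)) = x" using that by (simp add: h_def)
      then show ?thesis by (metis rangeI)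
    qed
    then have m: "ea_morphism T (coded T h) (code T h)"
      using h.ea_morphism_code by blast
    have "factors_uniquely E F T \<rho> (coded T h) (\<lambda>p. code T h (\<rho> p))"
      using tp h.effect_algebra_coded h.ea_bimorphism_code[OF \<rho>] sub \<rho>T
      unfolding tensor_product_def by blast
    moreover have "restrict (code T h) (carrier T) \<in> extensional (carrier T) \<and>
        ea_morphism T (coded T h) (restrict (code T h) (carrier T)) \<and>
        (\<forall>a\<in>carrier E. \<forall>b\<in>carrier F.
           code T h (\<rho> (a, b)) = restrict (code T h) (carrier T) (\<rho> (a, b)))"
      using ea_morphism_restrict[OF T m] \<rho>T by auto
    moreover have "restrict (\<lambda>x. code T h (\<pi> x)) (carrier T) \<in> extensional (carrier T) \<and>
        ea_morphism T (coded T h) (restrict (\<lambda>x. code T h (\<pi> x)) (carrier T)) \<and>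
        (\<forall>a\<in>carrier E. \<forall>b\<in>carrier F.
           code T h (\<rho> (a, b)) = restrict (\<lambda>x. code T h (\<pi> x)) (carrier T) (\<rho> (a, b)))"
      using ea_morphism_restrict[OF T ea_morphism_comp[OF \<pi>(1) m]] \<rho>T \<pi>(2)[symmetric] by auto
    ultimately have "restrict (code T h) (carrier T) = restrict (\<lambda>x. code T h (\<pi> x)) (carrier T)"
      unfolding factors_uniquely_def by blast
    then have "code T h t = code T h (\<pi> t)" using t by (metis restrict_apply')
    moreover have "\<pi> t \<in> carrier T" using \<pi>(1) t unfolding ea_morphism_def by blast
    ultimately have "t = \<pi> t" using h.code_eq_iff[OF sub sub] t by simp
    then show ?thesis using \<pi>(3)[OF t] by simp
  qed
  obtain \<phi> where \<phi>: "ea_morphism T L \<phi>"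
    "\<And>a b. a \<in> carrier E \<Longrightarrow> b \<in> carrier F \<Longrightarrow> \<beta> (a, b) = \<phi> (\<rho> (a, b))"
  proof (rule tensor_product_factors[OF tp L \<beta>])
    fix \<phi>
    assume "ea_morphism T L \<phi>"
      "\<And>a b. a \<in> carrier E \<Longrightarrow> b \<in> carrier F \<Longrightarrow> \<beta> (a, b) = \<phi> (\<rho> (a, b))"
    then show ?thesis by (rule that)
  qed
  show ?thesis
    unfolding factors_uniquely_def
  proof (rule ex1I[of _ "restrict \<phi> (carrier T)"])
    show "restrict \<phi> (carrier T) \<in> extensional (carrier T) \<and>
        ea_morphism T L (restrict \<phi> (carrier T)) \<and>
        (\<forall>a\<in>carrier E. \<forall>b\<in>carrier F. \<beta> (a, b) = restrict \<phi> (carrier T) (\<rho> (a, b)))"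
      using ea_morphism_restrict[OF T \<phi>(1)] \<phi>(2) \<rho>T by simp
  next
    fix \<psi>
    assume \<psi>: "\<psi> \<in> extensional (carrier T) \<and> ea_morphism T L \<psi> \<and>
        (\<forall>a\<in>carrier E. \<forall>b\<in>carrier F. \<beta> (a, b) = \<psi> (\<rho> (a, b)))"
    interpret g: coding T ?g using coding_bigen T \<rho> .
    have one: "\<psi> (one T) = \<phi> (one T)"
      using \<psi> \<phi>(1) unfolding ea_morphism_def by simp
    have "\<psi> (?g x) = \<phi> (?g x)" for x
      using \<psi> \<phi>(2) one by (auto simp: bigen_def split: sum.split)
    then have "\<psi> (evalt T ?g t) = \<phi> (evalt T ?g t)" for t
      using ea_morphisms_eq_evalt[OF T L _ \<phi>(1), of \<psi> ?g] \<psi> g.f_closed by blast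
    then have "\<psi> t = \<phi> t" if "t \<in> carrier T" for t using generated[OF that] by auto
    then show "\<psi> = restrict \<phi> (carrier T)"
      using \<psi> by (intro extensionalityI[of _ "carrier T"]) auto
  qed
qed

end

theory Submission
  imports Defs
begin

text \<open>A state operator is an idempotent endomorphism, so the universal property with target
  \<open>T\<close> itself governs its extensions: extending \<open>\<tau>\<close> means factoring
  (r, a) \<mapsto> \<open>\<rho> (r, \<tau> a)\<close> through \<open>\<rho>\<close>. Existence and
  uniqueness of that factorisation give one candidate, and uniqueness, used again, makes the
  candidate idempotent.\<close>

lemma state_operator_iff_idempotent_morphism:
  "state_operator E \<tau> \<longleftrightarrow> ea_morphism E E \<tau> \<and> (\<forall>a\<in>carrier E. \<tau> (\<tau> a) = \<tau> a)"
  unfolding state_operator_def ea_morphism_def by blast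

lemma ea_bimorphism_comp_right:
  assumes "ea_bimorphism E F L \<beta>" "ea_morphism G F \<phi>"
  shows "ea_bimorphism E G L (\<lambda>(a, b). \<beta> (a, \<phi> b))"
  using assms unfolding ea_bimorphism_def ea_morphism_def by simp

text \<open>The extension is the morphism induced by the bimorphism \<open>(r, a) \<mapsto> \<rho> (r, \<tau> a)\<close>. It is
  idempotent because its square factors the same bimorphism.\<close>

theorem lemma4p6:
  fixes E :: "'e effect_alg" and T :: "'t effect_alg"
    and \<rho> :: "real \<times> 'e \<Rightarrow> 't" and \<tau> :: "'e \<Rightarrow> 'e"
  assumes "effect_algebra E"
    and "state_operator E \<tau>"
    and "tensor_product unit_interval E T \<rho>"
  shows "\<exists>!\<tau>'. \<tau>' \<in> extensional (carrier T) \<and> state_operator T \<tau>' \<and>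
           extends_state_operator E \<rho> \<tau> \<tau>'"
proof -
  have T: "effect_algebra T" and \<rho>: "ea_bimorphism unit_interval E T \<rho>"
    using assms(3) unfolding tensor_product_def by auto
  have \<tau>: "ea_morphism E E \<tau>" and idem: "\<And>a. a \<in> carrier E \<Longrightarrow> \<tau> (\<tau> a) = \<tau> a"
    using assms(2) unfolding state_operator_iff_idempotent_morphism by auto
  have \<tau>E: "\<tau> a \<in> carrier E" if "a \<in> carrier E" for a
    using \<tau> that unfolding ea_morphism_def by blast
  have \<rho>T: "\<rho> (r, a) \<in> carrier T" if "r \<in> carrier unit_interval" "a \<in> carrier E" for r a
    using \<rho> that unfolding ea_bimorphism_def by blast
  let ?P = "\<lambda>\<phi>. \<phi> \<in> extensional (carrier T) \<and> ea_morphism T T \<phi> \<and>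
    extends_state_operator E \<rho> \<tau> \<phi>"
  \<comment> \<open>The definition of \<open>tensor_product\<close> only covers algebras of terms;
    \<open>tensor_product_universal\<close> admits \<open>T\<close> as the target.\<close>
  have "factors_uniquely unit_interval E T \<rho> T (\<lambda>(r, a). \<rho> (r, \<tau> a))"
    by (rule tensor_product_universal[OF assms(3) T ea_bimorphism_comp_right[OF \<rho> \<tau>]])
  then have ex1: "\<exists>!\<phi>. ?P \<phi>"
    unfolding factors_uniquely_def extends_state_operator_def by (simp add: eq_commute)
  then obtain \<phi> where \<phi>: "?P \<phi>" by blast
  \<comment> \<open>On generators the square yields \<open>\<rho> (r, \<tau> (\<tau> a))\<close>,
    which is \<open>\<rho> (r, \<tau> a)\<close>. Restricting makes it extensional, as
    \<open>ex1\<close> demands.\<close>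
  have "?P (restrict (\<lambda>t. \<phi> (\<phi> t)) (carrier T))"
  proof (intro conjI)
    show "ea_morphism T T (restrict (\<lambda>t. \<phi> (\<phi> t)) (carrier T))"
      using \<phi> ea_morphism_comp ea_morphism_restrict[OF T] by blast
    show "extends_state_operator E \<rho> \<tau> (restrict (\<lambda>t. \<phi> (\<phi> t)) (carrier T))"
      using \<phi> \<rho>T \<tau>E idem unfolding extends_state_operator_def by simp
  qed simp
  then have "restrict (\<lambda>t. \<phi> (\<phi> t)) (carrier T) = \<phi>"
    using ex1 \<phi> by blast
  then have "\<phi> (\<phi> t) = \<phi> t" if "t \<in> carrier T" for t
    using that by (metis restrict_apply')
  \<comment> \<open>Any rival state operator is in particular a morphism, so \<open>ex1\<close>
    excludes it.\<close>
  then show ?thesis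
    using ex1 \<phi> unfolding state_operator_iff_idempotent_morphism by blast
qed

end
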